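(* Let $p$ be a prime number, let $m$ be a positive integer that is not a power of $p$ (that is, $m\neq p^i$ for every integer $i\geq 0$; in particular $m\neq 1$), and let $w$ be a finite word of length $l\geq 1$ over the alphabet $\{0,1,\ldots,p-1\}$. Then $$\limsup_{n\to\infty}\frac{e_p(w;m^n)}{\log n}\geq\frac{\gamma(w)}{l\log p}.$$
   Context: For an integer $n\geq 1$ with base-$p$ expansion $n=\sum_{i=0}^{M}n_ip^i$, where $n_i\in\{0,\ldots,p-1\}$ and $M=\lfloor\log_p n\rfloor$ is the position of the most significant digit (so there are no leading zeros), write $(n)_p=n_Mn_{M-1}\cdots n_0$, regarded as a word over $\{0,1,\ldots,p-1\}$. For a nonempty finite word $w$ over $\{0,\ldots,p-1\}$, $e_p(w;n)$ denotes the number of (possibly overlapping) occurrences of $w$ as a block of consecutive letters in the word $(n)_p$. The word $w^2$ is the concatenation $ww$. Let $\gamma'(w)$ be the number of (possibly overlapping) occurrences of $w$ as a block of consecutive letters in $w^2$, and put $\gamma(w)=\gamma'(w)-1$. For example $\gamma(2020)=2$ and $\gamma(0^l)=l$. *)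

theory Defs
  imports
    "HOL-Library.Log_Nat"
    "HOL-Library.Extended_Real"
    "HOL-Computational_Algebra.Primes"
begin

text \<open>
  Words are lists of natural numbers, read from left to right. For \<open>p > 1\<close> and \<open>n > 0\<close>,
  \<open>floorlog p n\<close> is \<open>\<lfloor>log p n\<rfloor> + 1\<close>, the number of base-\<open>p\<close> digits of \<open>n\<close>, so the digit
  positions run from \<open>M = \<lfloor>log p n\<rfloor>\<close> (most significant, at the head of the list) down to \<open>0\<close>.
\<close>

definition base_word :: "nat \<Rightarrow> nat \<Rightarrow> nat list" where
  "base_word p n = map (\<lambda>i. n div p ^ i mod p) (rev [0..<floorlog p n])"

text \<open>Occurrences are counted by their starting positions, so they may overlap.\<close>

definition occurrences :: "'a list \<Rightarrow> 'a list \<Rightarrow> nat" where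
  "occurrences w u =
     card {i. i + length w \<le> length u \<and> take (length w) (drop i u) = w}"

definition block_count :: "nat \<Rightarrow> nat list \<Rightarrow> nat \<Rightarrow> nat" where
  "block_count p w n = occurrences w (base_word p n)"

definition gamma' :: "'a list \<Rightarrow> nat" where
  "gamma' w = occurrences w (w @ w)"

definition gamma :: "'a list \<Rightarrow> int" where
  "gamma w = int (gamma' w) - 1"

end

theory Submission
  imports Defs "HOL-Number_Theory.Residues" "HOL-Real_Asymp.Real_Asymp"
begin

text \<open>
  If \<open>p\<close> does not divide \<open>m > 1\<close>, some power \<open>q\<close> of \<open>m\<close> has the form \<open>1 + p ^ c * u\<close>
  with \<open>c \<ge> 2\<close> and \<open>\<not> p dvd u\<close>, and the powers of \<open>q\<close> run through all residues
  modulo \<open>p ^ (c + s)\<close> that are \<open>1\<close> modulo \<open>p ^ c\<close>, already with exponents in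
  \<open>{p ^ s..<2 * p ^ s}\<close>. Taking \<open>s = r * l\<close>, some such power ends in the \<open>r\<close>-fold repetition
  of \<open>w\<close> followed by \<open>c\<close> further digits, and so contains about \<open>r * gamma w\<close> occurrences of \<open>w\<close>,
  while the logarithm of the exponent is at most \<open>r * l * ln p + O(1)\<close>. A factor \<open>p ^ a\<close> of \<open>m\<close>
  only appends zeros to the expansion.
\<close>

section \<open>Occurrences in repetitions\<close>

lemma finite_occurrences: "finite {i. i + k \<le> length u \<and> P i}" for u :: "'a list"
  by (rule finite_subset[of _ "{..length u}"]) auto

lemma occurrences_infix: "occurrences w u \<le> occurrences w (a @ u @ b)"
proof -
  let ?f = "\<lambda>i. i + length a"
  have "card (?f ` {i. i + length w \<le> length u \<and> take (length w) (drop i u) = w})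
      \<le> occurrences w (a @ u @ b)"
    unfolding occurrences_def by (rule card_mono[OF finite_occurrences]) auto
  then show ?thesis
    unfolding occurrences_def by (subst (asm) card_image) auto
qed

text \<open>The occurrence starting at \<open>length w\<close> always exists and is the one that the
  subtraction of 1 removes, so what remains starts inside the first copy of
  \<open>w\<close>.\<close>

lemma gamma_eq_card:
  assumes "w \<noteq> []"
  shows "gamma w = int (card {i. i < length w \<and> take (length w) (drop i (w @ w)) = w})"
proof -
  let ?A = "{i. i < length w \<and> take (length w) (drop i (w @ w)) = w}"
  have "{i. i + length w \<le> length (w @ w) \<and> take (length w) (drop i (w @ w)) = w}
      = insert (length w) ?A" by auto
  then show ?thesis by (simp add: gamma_def gamma'_def occurrences_def)
qed

text \<open>A window starting in the first \<open>w\<close> stays inside \<open>w @ w\<close> and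
  cannot see \<open>u\<close>. Starts from \<open>length w\<close> onwards are shifted occurrences
  in \<open>w @ u\<close>, so the two families are disjoint.\<close>

lemma occurrences_square_append:
  "card {i. i < length w \<and> take (length w) (drop i (w @ w)) = w} + occurrences w (w @ u)
    \<le> occurrences w (w @ w @ u)"
proof -
  let ?A = "{i. i < length w \<and> take (length w) (drop i (w @ w)) = w}"
  let ?B = "{i. i + length w \<le> length (w @ u) \<and> take (length w) (drop i (w @ u)) = w}"
  let ?f = "\<lambda>i. i + length w"
  have "take (length w) (drop i (w @ w @ u)) = take (length w) (drop i (w @ w))"
    if "i < length w" for i
    using that by simp
  then have "?A \<union> ?f ` ?B
      \<subseteq> {i. i + length w \<le> length (w @ w @ u) \<and> take (length w) (drop i (w @ w @ u)) = w}"
    by auto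
  then have "card (?A \<union> ?f ` ?B) \<le> occurrences w (w @ w @ u)"
    unfolding occurrences_def by (rule card_mono[OF finite_occurrences])
  moreover have "card (?A \<union> ?f ` ?B) = card ?A + card (?f ` ?B)"
    by (rule card_Un_disjoint) (auto intro: finite_occurrences)
  moreover have "card (?f ` ?B) = card ?B"
    by (rule card_image) auto
  ultimately show ?thesis by (simp add: occurrences_def)
qed

text \<open>Among \<open>Suc r\<close> copies there are \<open>r\<close> adjacent pairs, each
  contributing \<open>gamma w\<close> starts.\<close>

lemma occurrences_replicate:
  assumes "w \<noteq> []"
  shows "int r * gamma w \<le> int (occurrences w (concat (replicate (Suc r) w)))"
proof (induction r)
  case (Suc r)
  then show ?case
    using occurrences_square_append[of w "concat (replicate r w)"]
    by (simp add: gamma_eq_card[OF assms] algebra_simps)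
qed simp

section \<open>Digits\<close>

text \<open>Unlike \<open>base_word\<close>, this pads with zeros to a fixed length, so words with
  leading zeros are covered too.\<close>

definition low_digits :: "nat \<Rightarrow> nat \<Rightarrow> nat \<Rightarrow> nat list" where
  "low_digits p k n = map (\<lambda>i. n div p ^ i mod p) (rev [0..<k])"

lemma low_digits_Suc: "low_digits p (Suc k) n = low_digits p k (n div p) @ [n mod p]"
proof -
  have "[0..<Suc k] = 0 # map Suc [0..<k]"
    by (simp add: upt_conv_Cons map_Suc_upt)
  then show ?thesis
    by (simp add: low_digits_def rev_map div_mult2_eq)
qed

lemma low_digits_0 [simp]: "low_digits p 0 n = []"
  by (simp add: low_digits_def)

lemma low_digits_add: "low_digits p (k + c) n = low_digits p k (n div p ^ c) @ low_digits p c n"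
  by (induction c arbitrary: n) (simp_all add: low_digits_Suc div_mult2_eq)

lemma low_digits_mod: "low_digits p k (n mod p ^ k) = low_digits p k n"
proof (induction k arbitrary: n)
  case (Suc k)
  have "n mod p ^ Suc k div p = n div p mod p ^ k"
    unfolding power_Suc mod_mult2_eq by (cases "p = 0") simp_all
  then show ?case
    using Suc by (simp add: low_digits_Suc mod_mod_cancel)
qed simp

lemma low_digits_surj:
  assumes "set v \<subseteq> {..<p}"
  shows "\<exists>n. low_digits p (length v) n = v"
  using assms
proof (induction v rule: rev_induct)
  case (snoc a v)
  then obtain n where n: "low_digits p (length v) n = v" and a: "a < p" by auto
  have "low_digits p (length (v @ [a])) (n * p + a) = v @ [a]"
    using n a by (simp add: low_digits_Suc)
  then show ?case by blast
qed simp

text \<open>The bound \<open>p ^ k \<le> n\<close> gives more than \<open>k\<close> digits, so the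
  low \<open>k\<close> digits are a true suffix without padding.\<close>

lemma base_word_append:
  assumes "p > 1" "p ^ k \<le> n"
  shows "base_word p n = low_digits p (floorlog p n - k) (n div p ^ k) @ low_digits p k n"
proof -
  have "Suc k \<le> floorlog p n"
    using assms by (intro floorlog_ge_SucI) auto
  then show ?thesis
    using low_digits_add[of p "floorlog p n - k" k n]
    by (simp add: base_word_def low_digits_def)
qed

lemma block_count_mult_power:
  assumes "p > 1" "n > 0"
  shows "block_count p w n \<le> block_count p w (n * p ^ k)"
proof -
  have "base_word p (n * p ^ k) = base_word p n @ low_digits p k (n * p ^ k)"
    using base_word_append[of p k "n * p ^ k"] assms
    by (simp add: base_word_def low_digits_def)
  then show ?thesis
    using occurrences_infix[of w "base_word p n" "[]"] by (simp add: block_count_def)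
qed

text \<open>Since \<open>c > 0\<close>, the summand 1 fits into the last \<open>c\<close> digits and
  leaves the digits of \<open>x\<close> above them intact.\<close>

lemma block_count_ge_if_cong:
  assumes "p > 1" "c > 0" "p ^ (length v + c) \<le> n"
    and cong: "[n = 1 + p ^ c * x] (mod p ^ (length v + c))"
    and x: "low_digits p (length v) x = v"
  shows "occurrences w v \<le> block_count p w n"
proof -
  let ?k = "length v + c"
  have "low_digits p ?k n = low_digits p ?k (1 + p ^ c * x)"
    using arg_cong[OF cong[unfolded unique_euclidean_semiring_class.cong_def], of "low_digits p ?k"]
    by (simp only: low_digits_mod)
  also have "\<dots> = low_digits p (length v) ((1 + p ^ c * x) div p ^ c)
      @ low_digits p c (1 + p ^ c * x)"
    by (rule low_digits_add)
  also have "(1 + p ^ c * x) div p ^ c = x"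
    using one_less_power[OF assms(1,2)]
      div_mult_self2[of "p ^ c" 1 x] assms(1) by simp
  finally have "low_digits p ?k n = v @ low_digits p c (1 + p ^ c * x)"
    by (simp add: x)
  then show ?thesis
    using base_word_append[OF assms(1,3)] occurrences_infix
    by (simp add: block_count_def)
qed

section \<open>Powers congruent to 1\<close>

lemma power_one_plus: "\<exists>z. (1 + a) ^ n = 1 + n * a + a ^ 2 * z" for a n :: nat
proof (induction n)
  case (Suc n)
  then obtain z where z: "(1 + a) ^ n = 1 + n * a + a ^ 2 * z" ..
  have "(1 + a) ^ Suc n = 1 + Suc n * a + a ^ 2 * (n + z + a * z)"
    unfolding power_Suc z by (simp add: algebra_simps power2_eq_square)
  then show ?case ..
qed simp

text \<open>Requiring \<open>c \<ge> 2\<close> makes \<open>p = 2\<close> unexceptional.\<close>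

lemma power_prime_power_form:
  fixes p c u q :: nat
  assumes "prime p" "c \<ge> 2" "\<not> p dvd u" "q = 1 + p ^ c * u"
  shows "\<exists>u'. \<not> p dvd u' \<and> q ^ (p ^ s) = 1 + p ^ (c + s) * u'"
proof (induction s)
  case 0
  then show ?case using assms by auto
next
  case (Suc s)
  then obtain u' where u': "\<not> p dvd u'" "q ^ (p ^ s) = 1 + p ^ (c + s) * u'" by blast
  obtain z where z: "(1 + p ^ (c + s) * u') ^ p
      = 1 + p * (p ^ (c + s) * u') + (p ^ (c + s) * u') ^ 2 * z"
    using power_one_plus by blast
  \<comment> \<open>With \<open>c = e + 2\<close>, the square of \<open>p ^ (c + s)\<close> is
    \<open>p ^ (c + Suc s)\<close> times \<open>p * p ^ (e + s)\<close>; the spare factor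
    \<open>p\<close> keeps the new cofactor prime to \<open>p\<close>.\<close>
  obtain e where e: "c = e + 2" using assms(2) by (metis add.commute le_Suc_ex)
  have "q ^ (p ^ Suc s) = (q ^ (p ^ s)) ^ p"
    by (simp add: power_mult[symmetric] mult.commute)
  also have "\<dots> = 1 + p ^ (c + Suc s) * (u' + p * (p ^ (e + s) * u' ^ 2 * z))"
    unfolding u' z by (simp add: e algebra_simps power_add power2_eq_square)
  finally have "q ^ (p ^ Suc s) = 1 + p ^ (c + Suc s) * (u' + p * (p ^ (e + s) * u' ^ 2 * z))" .
  moreover have "\<not> p dvd u' + p * (p ^ (e + s) * u' ^ 2 * z)"
    using u'(1) by (simp add: dvd_add_left_iff)
  ultimately show ?case by blast
qed

text \<open>Lifting digit by digit: multiplying \<open>q ^ j\<close> by powers of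
  \<open>q ^ (p ^ s)\<close>, which is 1 plus a unit times \<open>p ^ (c + s)\<close>, keeps the
  residue modulo \<open>p ^ (c + s)\<close> and can set the next digit to any value.\<close>

lemma power_cong_surj:
  fixes p c u q x :: nat
  assumes "prime p" "c \<ge> 2" "\<not> p dvd u" "q = 1 + p ^ c * u"
  shows "\<exists>j < p ^ s. [q ^ j = 1 + p ^ c * x] (mod p ^ (c + s))"
proof (induction s)
  case 0
  have "[q ^ 0 = 1 + p ^ c * x] (mod p ^ (c + 0))"
    by (simp only: unique_euclidean_semiring_class.cong_def mod_mult_self2 power_0 add_0_right)
  then show ?case by (intro exI[of _ 0]) auto
next
  case (Suc s)
  let ?P = "p ^ (c + s)" and ?X = "int (1 + p ^ c * x)"
  obtain j where j: "j < p ^ s" "[q ^ j = 1 + p ^ c * x] (mod ?P)" using Suc by blast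
  obtain u' where u': "\<not> p dvd u'" "q ^ (p ^ s) = 1 + ?P * u'"
    using power_prime_power_form[OF assms] by blast
  have "[int (q ^ j) = ?X] (mod int ?P)"
    using j(2) by (simp only: cong_int_iff)
  \<comment> \<open>The error \<open>y\<close> may be negative, hence the passage to
    integers.\<close>
  then obtain y where y: "int (q ^ j) = ?X + int ?P * y"
    using cong_sym[THEN cong_iff_lin[THEN iffD1]] by blast
  have p1: "p > 1" using assms(1) prime_gt_1_nat by blast
  have pc: "p dvd p ^ c" using assms(2) by (simp add: dvd_power)
  have "\<not> p dvd q ^ j"
  proof
    assume "p dvd q ^ j"
    then have "p dvd q" using assms(1) prime_dvd_power by blast
    then have "p dvd 1"
      using pc assms(4) by (metis dvd_add_left_iff dvd_mult2)
    then show False using p1 by simp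
  qed
  then have "coprime (q ^ j * u') p"
    using u'(1) assms(1) by (metis coprime_commute prime_dvd_mult_nat prime_imp_coprime)
  then have "coprime (int (q ^ j * u')) (int p)" by (simp only: coprime_int_iff)
  then obtain b where b: "[int (q ^ j * u') * b = 1] (mod int p)"
    using cong_solve_coprime_int by blast
  \<comment> \<open>As \<open>b\<close> inverts \<open>q ^ j * u'\<close> modulo \<open>p\<close>,
    this \<open>t\<close> makes \<open>q ^ j * u' * t + y\<close> divisible by \<open>p\<close>,
    cancelling the error in the next digit.\<close>
  define t where "t = nat ((- b * y) mod int p)"
  have t: "int t = (- b * y) mod int p" "t < p"
    using p1 by (simp_all add: t_def nat_less_iff)
  have "[int (q ^ j * u') * int t = int (q ^ j * u') * (- b * y)] (mod int p)"
    unfolding t(1) by (intro cong_mult cong_refl) (simp add: unique_euclidean_semiring_class.cong_def)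
  also have "int (q ^ j * u') * (- b * y) = (int (q ^ j * u') * b) * (- y)" by simp
  also have "[\<dots> = 1 * (- y)] (mod int p)" by (intro cong_mult b cong_refl)
  finally have "[int (q ^ j * u') * int t + y = 1 * (-y) + y] (mod int p)"
    by (intro cong_add cong_refl)
  then have "int p dvd int (q ^ j * u') * int t + y" by (simp add: cong_0_iff)
  then obtain f where f: "int (q ^ j * u') * int t + y = int p * f" ..
  obtain z where z: "(1 + ?P * u') ^ t = 1 + t * (?P * u') + (?P * u') ^ 2 * z"
    using power_one_plus by blast
  obtain e where e: "c + s = Suc e" using assms(2) by (cases "c + s") auto
  have "int (q ^ (j + p ^ s * t)) = int (q ^ j) * int ((1 + ?P * u') ^ t)"
    by (simp add: power_add power_mult u')
  also have "\<dots> = ?X + int ?P * y + int (q ^ j) * (int t * (int ?P * int u')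
      + int ((?P * u') ^ 2 * z))"
    unfolding z using y by (simp add: algebra_simps)
  also have "\<dots> = ?X + int ?P * (int (q ^ j * u') * int t + y)
      + int ?P * int ?P * (int (q ^ j) * int (u' ^ 2 * z))"
    by (simp add: algebra_simps power2_eq_square)
  also have "\<dots> = ?X + int (p ^ (c + Suc s)) * (f + int (p ^ e) * (int (q ^ j) * int (u' ^ 2 * z)))"
    unfolding f by (simp add: e algebra_simps)
  finally have "[int (q ^ (j + p ^ s * t)) = ?X] (mod int (p ^ (c + Suc s)))"
    by (simp add: unique_euclidean_semiring_class.cong_def)
  then have "[q ^ (j + p ^ s * t) = 1 + p ^ c * x] (mod p ^ (c + Suc s))"
    by (simp only: cong_int_iff)
  moreover have "j + p ^ s * t < p ^ Suc s"
  proof -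
    have "j + p ^ s * t < p ^ s * Suc t" using j(1) by simp
    also have "\<dots> \<le> p ^ s * p" using t(2) by (intro mult_left_mono) auto
    finally show ?thesis by (simp add: mult.commute)
  qed
  ultimately show ?case by blast
qed

text \<open>The shift by the period \<open>p ^ s\<close> makes the power exceed the modulus.\<close>

lemma power_cong_surj_large:
  fixes p c u q x :: nat
  assumes "prime p" "c \<ge> 2" "\<not> p dvd u" "q = 1 + p ^ c * u"
  shows "\<exists>j. p ^ s \<le> j \<and> j < 2 * p ^ s \<and> p ^ (c + s) \<le> q ^ j \<and>
    [q ^ j = 1 + p ^ c * x] (mod p ^ (c + s))"
proof -
  obtain j where j: "j < p ^ s" "[q ^ j = 1 + p ^ c * x] (mod p ^ (c + s))"
    using power_cong_surj[OF assms] by blast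
  obtain u' where u': "\<not> p dvd u'" "q ^ (p ^ s) = 1 + p ^ (c + s) * u'"
    using power_prime_power_form[OF assms] by blast
  have "u' > 0" using u'(1) by (cases u') auto
  then have "p ^ (c + s) * 1 \<le> p ^ (c + s) * u'" by (intro mult_left_mono) auto
  then have "p ^ (c + s) \<le> q ^ (p ^ s)" using u'(2) by linarith
  also have "\<dots> \<le> q ^ (p ^ s + j)"
    using assms(4) by (intro power_increasing) auto
  finally have "p ^ (c + s) \<le> q ^ (p ^ s + j)" .
  moreover have "[q ^ (p ^ s) * q ^ j = 1 * (1 + p ^ c * x)] (mod p ^ (c + s))"
    unfolding u' by (intro cong_mult j(2)) (simp only: unique_euclidean_semiring_class.cong_def mod_mult_self2)
  ultimately show ?thesis
    using j(1) by (intro exI[of _ "p ^ s + j"]) (simp add: power_add)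
qed

text \<open>Euler's theorem modulo \<open>p ^ 2\<close>, rather than \<open>p\<close>, yields
  \<open>c \<ge> 2\<close>. Taking \<open>c\<close> as the full multiplicity of \<open>p\<close> in
  \<open>m ^ d - 1\<close>, nonzero as \<open>m > 1\<close>, makes \<open>u\<close> prime to
  \<open>p\<close>.\<close>

lemma power_form_exists:
  fixes p m :: nat
  assumes "prime p" "\<not> p dvd m" "m > 1"
  shows "\<exists>d c u. d > 0 \<and> c \<ge> 2 \<and> \<not> p dvd u \<and> m ^ d = 1 + p ^ c * u"
proof -
  define d where "d = totient (p ^ 2)"
  have d: "d > 0" using assms(1) by (simp add: d_def prime_gt_0_nat)
  have md: "m ^ d > 1" using assms(3) d by (rule one_less_power)
  have "coprime m p"
    using assms by (metis coprime_commute prime_imp_coprime)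
  then have "[m ^ d = 1] (mod p ^ 2)"
    unfolding d_def by (intro euler_theorem) simp
  then have dv: "p ^ 2 dvd m ^ d - 1"
    using md by (simp add: cong_altdef_nat)
  have nz: "m ^ d - 1 \<noteq> 0" "\<not> is_unit p" using md assms(1) by auto
  then obtain u where u: "m ^ d - 1 = p ^ multiplicity p (m ^ d - 1) * u" "\<not> p dvd u"
    using multiplicity_decompose' by blast
  have "2 \<le> multiplicity p (m ^ d - 1)"
    using dv nz by (intro multiplicity_geI) auto
  then show ?thesis using u d md by (metis le_add_diff_inverse less_imp_le_nat)
qed

section \<open>Exponents with many occurrences, and the limit superior\<close>

text \<open>The lower bound on \<open>n\<close> sends the exponents to infinity with
  \<open>r\<close>; the upper bound, with \<open>D\<close> independent of \<open>r\<close>, controls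
  \<open>ln n\<close>.\<close>

lemma block_count_power_ge:
  fixes p m :: nat
  assumes "prime p" "m > 0" "\<forall>i::nat. m \<noteq> p ^ i" "w \<noteq> []" "set w \<subseteq> {..<p}"
  shows "\<exists>D>0. \<forall>r. \<exists>n. p ^ (Suc r * length w) \<le> n \<and> n \<le> D * p ^ (Suc r * length w) \<and>
    int r * gamma w \<le> int (block_count p w (m ^ n))"
proof -
  have p1: "p > 1" using assms(1) prime_gt_1_nat by blast
  have "m \<noteq> 0" "\<not> is_unit p" using assms(2) p1 by auto
  then obtain m' where m': "m = p ^ multiplicity p m * m'" "\<not> p dvd m'"
    by (rule multiplicity_decompose')
  define a where "a = multiplicity p m"
  have ma: "m = p ^ a * m'" using m'(1) by (simp only: a_def)
  have "m' \<noteq> 0" using ma assms(2) by auto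
  \<comment> \<open>Otherwise \<open>m\<close> would be the power \<open>p ^ a\<close>.\<close>
  moreover have "m' \<noteq> 1" using ma assms(3) by (metis mult_1_right)
  ultimately have m1: "m' > 1" by simp
  obtain d c u where d: "d > 0" "c \<ge> 2" "\<not> p dvd u" "m' ^ d = 1 + p ^ c * u"
    using power_form_exists[OF assms(1) m'(2) m1] by blast
  \<comment> \<open>The exponent will be \<open>d * j\<close> with
    \<open>j < 2 * p ^ length v\<close>, whence the constant \<open>2 * d\<close>.\<close>
  have "\<exists>n. p ^ (Suc r * length w) \<le> n \<and> n \<le> 2 * d * p ^ (Suc r * length w) \<and>
    int r * gamma w \<le> int (block_count p w (m ^ n))" for r
  proof -
    define v where "v = concat (replicate (Suc r) w)"
    have len: "length v = Suc r * length w"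
      by (simp add: v_def length_concat sum_list_replicate)
    have "set v \<subseteq> {..<p}" using assms(5) by (auto simp: v_def)
    then obtain x where x: "low_digits p (length v) x = v" using low_digits_surj by blast
    obtain j where j: "p ^ length v \<le> j" "j < 2 * p ^ length v"
      "p ^ (c + length v) \<le> (m' ^ d) ^ j" "[(m' ^ d) ^ j = 1 + p ^ c * x] (mod p ^ (c + length v))"
      using power_cong_surj_large[OF assms(1) d(2-4)] by blast
    have "occurrences w v \<le> block_count p w ((m' ^ d) ^ j)"
      using p1 d(2) j(3,4) x
      by (intro block_count_ge_if_cong[where c = c and x = x]) (simp_all add: add.commute)
    also have "\<dots> \<le> block_count p w ((m' ^ d) ^ j * p ^ (a * (d * j)))"
      using p1 m1 by (intro block_count_mult_power) auto
    also have "(m' ^ d) ^ j * p ^ (a * (d * j)) = m ^ (d * j)"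
      by (simp add: ma power_mult_distrib power_mult)
    finally have "int r * gamma w \<le> int (block_count p w (m ^ (d * j)))"
      using occurrences_replicate[OF assms(4), of r] by (simp add: v_def)
    moreover have "p ^ length v \<le> d * j"
      using j(1) mult_le_mono[of 1 d "p ^ length v" j] d(1) by simp
    moreover have "d * j \<le> 2 * d * p ^ length v"
      using j(2) mult_le_mono2[of j "2 * p ^ length v" d] by (simp add: ac_simps)
    ultimately show ?thesis unfolding len by blast
  qed
  then show ?thesis using d(1) by (intro exI[of _ "2 * d"]) auto
qed

theorem theorem1p2:
  fixes p m l :: nat and w :: "nat list"
  assumes "prime p"
    and "m > 0"
    and "\<forall>i::nat. m \<noteq> p ^ i"
    and "l \<ge> 1"
    and "length w = l"
    and "set w \<subseteq> {..<p}"
  shows "limsup (\<lambda>n::nat. ereal (real (block_count p w (m ^ n)) / ln (real n)))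
           \<ge> ereal (real_of_int (gamma w) / (real l * ln (real p)))"
proof (rule ccontr)
  let ?f = "\<lambda>n::nat. ereal (real (block_count p w (m ^ n)) / ln (real n))"
  define g where "g = real_of_int (gamma w)"
  define K where "K = real l * ln (real p)"
  assume "\<not> ?thesis"
  then have "limsup ?f < ereal (g / K)" by (simp add: g_def K_def)
  \<comment> \<open>If the claim fails, the quotients eventually stay below some
    \<open>C < g / K\<close>; exponents \<open>n\<close> with a quotient above \<open>C\<close> will
    contradict this.\<close>
  then obtain C where C: "limsup ?f < ereal C" "C < g / K"
    using ereal_dense2 by force
  obtain N where N: "\<And>n. n \<ge> N \<Longrightarrow> ?f n < ereal C"
    using Limsup_lessD[OF C(1)] unfolding eventually_sequentially by blast
  have w: "w \<noteq> []" using assms(4,5) by auto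
  have p1: "p > 1" using assms(1) prime_gt_1_nat by blast
  have K: "K > 0" using p1 assms(4) by (simp add: K_def)
  have g: "g \<ge> 0" by (simp add: g_def gamma_eq_card[OF w])
  obtain D where D: "D > 0" "\<And>r. \<exists>n. p ^ (Suc r * l) \<le> n \<and> n \<le> D * p ^ (Suc r * l) \<and>
      int r * gamma w \<le> int (block_count p w (m ^ n))"
    using block_count_power_ge[OF assms(1-3) w assms(6)] assms(5) by blast
  \<comment> \<open>This is the lower bound for the quotient at the \<open>r\<close>-th exponent;
    the constant \<open>ln D\<close> and the one extra copy of \<open>w\<close> vanish in the
    limit.\<close>
  have "((\<lambda>r::nat. real r * g / (ln (real D) + (real r + 1) * K)) \<longlongrightarrow> g * inverse K) at_top"
    using K by real_asymp
  then have "eventually (\<lambda>r::nat. C < real r * g / (ln (real D) + (real r + 1) * K)) at_top"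
    using C(2) unfolding divide_inverse by (rule order_tendstoD)
  then obtain r where r: "r \<ge> N" "C < real r * g / (ln (real D) + (real r + 1) * K)"
    using eventually_conj[OF eventually_ge_at_top[of N]] eventually_happens'[OF sequentially_bot]
    by blast
  obtain n where n: "p ^ (Suc r * l) \<le> n" "n \<le> D * p ^ (Suc r * l)"
      "int r * gamma w \<le> int (block_count p w (m ^ n))"
    using D(2) by blast
  \<comment> \<open>From \<open>n > Suc r\<close> follow both \<open>n \<ge> N\<close> and
    \<open>ln n > 0\<close>.\<close>
  have "Suc r \<le> Suc r * l" using assms(4) by (cases l) auto
  also have "\<dots> < p ^ (Suc r * l)" using p1 by (intro power_gt_expt) simp
  also note n(1)
  finally have rn: "Suc r < n" .
  then have ln: "ln (real n) > 0" by simp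
  have "ln (real n) \<le> ln (real (D * p ^ (Suc r * l)))"
    using n(2) rn by (intro ln_mono) (simp_all only: of_nat_le_iff of_nat_0_less_iff)
  also have "\<dots> = ln (real D) + (real r + 1) * K"
    using D(1) p1 by (simp add: ln_mult ln_realpow K_def algebra_simps)
  finally have le: "ln (real n) \<le> ln (real D) + (real r + 1) * K" .
  have "real r * g \<le> real (block_count p w (m ^ n))"
    using of_int_le_iff[where 'a = real, THEN iffD2, OF n(3)] by (simp add: g_def)
  then have "real r * g / ln (real n) \<le> real (block_count p w (m ^ n)) / ln (real n)"
    using ln by (intro divide_right_mono) auto
  \<comment> \<open>Enlarging the denominator lowers the fraction because
    \<open>g \<ge> 0\<close>.\<close>
  moreover have "real r * g / (ln (real D) + (real r + 1) * K) \<le> real r * g / ln (real n)"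
    using le ln g by (intro divide_left_mono) auto
  ultimately have "C < real (block_count p w (m ^ n)) / ln (real n)"
    using r(2) by linarith
  with N[of n] rn r(1) show False by auto
qed

end
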